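(* Let $N$ be a finite nonempty set with $n=|N|$ elements, let $p,q\in\mathbb{R}$ with $q>p\geq 0$, and let $Q=[q_{ij}]\in\mathbb{R}^{N\times N}$ be the regular matrix with $q_{ii}=q$ for all $i\in N$ and $q_{ij}=p$ for all $i\neq j$. Let $c\in\mathbb{R}^N$ and $g\in\mathbb{R}$, and put $C=\sum_{i\in N}c_i$. Then the solution $(x^*,z^* )\in\mathbb{R}^N\times\mathbb{R}$ of the linear system $$Qx-\tfrac{z}{2}\mathbf{1}=\tfrac{c}{2},\qquad \mathbf{1}^Tx=g$$ is given by $$z^*=\frac{2\bigl(q+(n-1)p\bigr)g-C}{n},\qquad x_i^*=\frac{c_i+z^*-2pg}{2q-2p}\quad(i\in N).$$ If $Q$ is furthermore positive definite, then $x^*$ is an optimal solution of the optimization problem $$\min_{x\in\mathbb{R}^N}\ x^TQx-c^Tx\quad\text{subject to}\quad \mathbf{1}^Tx=g .$$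
   Context: $\mathbf{1}\in\mathbb{R}^N$ denotes the vector all of whose components equal $1$, so $\mathbf{1}^Tx=\sum_{i\in N}x_i$. A square matrix $Q=[q_{ij}]$ is called regular if there are real numbers $p,q$ such that $q_{ij}=q$ if $i=j$ and $q_{ij}=p$ if $i\neq j$ (this is not the usual notion of an invertible matrix). *)

theory Defs
  imports "HOL-Analysis.Analysis"
begin

text \<open>``Regular'' is a condition on the entries and has nothing to do with invertibility:
  a square matrix is regular if it satisfies the following predicate for some reals q and p.\<close>

definition regular_with :: "real \<Rightarrow> real \<Rightarrow> real ^ 'n ^ 'n \<Rightarrow> bool" where
  "regular_with q p Q \<longleftrightarrow> (\<forall>i j. Q $ i $ j = (if i = j then q else p))"

text \<open>Symmetry is not part of the definition; regular matrices are symmetric anyway.\<close>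

definition positive_definite :: "real ^ 'n ^ 'n \<Rightarrow> bool" where
  "positive_definite Q \<longleftrightarrow> (\<forall>x. x \<noteq> 0 \<longrightarrow> x \<bullet> (Q *v x) > 0)"

end

theory Submission
  imports Defs
begin

text \<open>Since \<open>Q = (q - p) I + p 1 1\<^sup>T\<close>, the \<open>i\<close>-th equation under the constraint \<open>1 \<bullet> x = g\<close> only
  involves \<open>x\<^sub>i\<close> and \<open>z\<close>; summing the resulting expressions for \<open>x\<^sub>i\<close> determines \<open>z\<close>.
  The linear system is the Lagrange condition of the minimization problem: at a solution \<open>x\<close> the
  objective changes along a feasible direction \<open>d\<close> by \<open>d \<bullet> Q d + z (1 \<bullet> d) = d \<bullet> Q d \<ge> 0\<close>.\<close>

lemma inner_one_vec: "1 \<bullet> (x :: real ^ 'n) = (\<Sum>i\<in>UNIV. x $ i)"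
  by (simp add: inner_vec_def)

lemma regular_with_mult_vec:
  fixes x :: "real ^ 'n"
  assumes "regular_with q p Q"
  shows "Q *v x = (q - p) *\<^sub>R x + (p * (1 \<bullet> x)) *\<^sub>R 1"
proof -
  have "(Q *v x) $ i = (q - p) * x $ i + p * (1 \<bullet> x)" for i
  proof -
    \<comment> \<open>The diagonal entry is split as \<open>q = (q - p) + p\<close>, so that
      \<open>p\<close> multiplies every coordinate.\<close>
    have "(Q *v x) $ i = (\<Sum>j\<in>UNIV. (if i = j then (q - p) * x $ j else 0) + p * x $ j)"
      using assms unfolding matrix_vector_mult_def regular_with_def
      by (auto intro!: sum.cong simp: algebra_simps)
    then show ?thesis
      by (simp add: sum.distrib inner_one_vec sum_distrib_left)
  qed
  then show ?thesis
    by (simp add: vec_eq_iff)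
qed

text \<open>Both sides expand to \<open>(q - p) * (x \<bullet> y) + p * (1 \<bullet> x) * (1
  \<bullet> y)\<close>.\<close>

lemma regular_with_inner_commute:
  assumes "regular_with q p Q"
  shows "x \<bullet> (Q *v y) = y \<bullet> (Q *v x)"
  by (simp add: regular_with_mult_vec[OF assms] inner_add_right inner_commute)

text \<open>Stated as an equivalence, this gives existence and uniqueness of the solution
  together.\<close>

lemma regular_system_iff:
  fixes Q :: "real ^ 'n ^ 'n"
  assumes "regular_with q p Q" and "q \<noteq> p"
  shows "Q *v x - (z / 2) *\<^sub>R 1 = (1 / 2) *\<^sub>R c \<and> 1 \<bullet> x = g \<longleftrightarrow>
    (\<forall>i. x $ i = (c $ i + z - 2 * p * g) / (2 * q - 2 * p)) \<and>
    z = (2 * (q + (real CARD('n) - 1) * p) * g - (\<Sum>i\<in>UNIV. c $ i)) / real CARD('n)"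
    (is "?system \<longleftrightarrow> ?X \<and> ?Z")
proof -
  have nz: "2 * q - 2 * p \<noteq> 0"
    using assms(2) by simp
  have sum_iff: "1 \<bullet> x = g \<longleftrightarrow> ?Z" if ?X
  proof -
    have "1 \<bullet> x = ((\<Sum>i\<in>UNIV. c $ i) + real CARD('n) * (z - 2 * p * g)) / (2 * q - 2 * p)"
      using that by (simp add: inner_one_vec add_diff_eq[symmetric] sum.distrib
          flip: sum_divide_distrib)
    then have "1 \<bullet> x = g \<longleftrightarrow>
        (\<Sum>i\<in>UNIV. c $ i) + real CARD('n) * (z - 2 * p * g) = g * (2 * q - 2 * p)"
      using nz by (simp add: divide_eq_eq)
    also have "\<dots> \<longleftrightarrow> ?Z"
      by (auto simp: field_simps)
    finally show ?thesis .
  qed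
  have "Q *v x - (z / 2) *\<^sub>R 1 = (1 / 2) *\<^sub>R c \<longleftrightarrow> ?X" if "1 \<bullet> x = g"
    using nz that by (simp add: regular_with_mult_vec[OF assms(1)] vec_eq_iff eq_divide_eq)
      (simp add: field_simps)
  \<comment> \<open>The constraint makes the matrix equation equivalent to \<open>?X\<close>, and
    \<open>?X\<close> makes the constraint equivalent to \<open>?Z\<close>; chaining these gives
    both directions.\<close>
  then show ?thesis
    using sum_iff by blast
qed

lemma lagrange_point_is_arg_min:
  fixes Q :: "real ^ 'n ^ 'n"
  assumes sym: "\<And>x y. x \<bullet> (Q *v y) = y \<bullet> (Q *v x)"
    and pd: "positive_definite Q"
    and stationary: "Q *v x - (z / 2) *\<^sub>R 1 = (1 / 2) *\<^sub>R c"
    and feasible: "1 \<bullet> x = g"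
  shows "is_arg_min (\<lambda>x. x \<bullet> (Q *v x) - c \<bullet> x) (\<lambda>x. 1 \<bullet> x = g) x"
proof -
  have c: "c = 2 *\<^sub>R (Q *v x) - z *\<^sub>R 1"
  proof -
    have "c = 2 *\<^sub>R ((1 / 2) *\<^sub>R c)"
      by simp
    then show ?thesis
      unfolding stationary[symmetric] by (simp add: scaleR_diff_right)
  qed
  have "x \<bullet> (Q *v x) - c \<bullet> x \<le> y \<bullet> (Q *v y) - c \<bullet> y" if "1 \<bullet> y = g" for y
  proof -
    define d where "d = y - x"
    have y: "y = x + d" and d: "1 \<bullet> d = 0"
      using that feasible by (simp_all add: d_def inner_diff_right)
    have "d \<bullet> (Q *v d) \<ge> 0"
      using pd by (cases "d = 0") (auto simp: positive_definite_def less_imp_le)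
    \<comment> \<open>The multiplier term of \<open>c\<close> vanishes because
      \<open>1 \<bullet> d = 0\<close>.\<close>
    moreover have "c \<bullet> d = 2 * (d \<bullet> (Q *v x))"
      by (simp add: c inner_diff_left d inner_commute[of d])
    \<comment> \<open>By symmetry the two cross terms add up to
      \<open>2 * (d \<bullet> (Q *v x))\<close>, which \<open>c \<bullet> d\<close> cancels.\<close>
    then have "y \<bullet> (Q *v y) - c \<bullet> y = x \<bullet> (Q *v x) - c \<bullet> x + d \<bullet> (Q *v d)"
      using sym[of x d]
      by (simp add: y matrix_vector_right_distrib inner_add_left inner_add_right)
    ultimately show ?thesis
      by simp
  qed
  then show ?thesis
    using feasible by (auto simp: is_arg_min_def not_less)
qed

theorem theorem4p1:
  fixes Q :: "real ^ 'n ^ 'n" and c xs :: "real ^ 'n" and p q g n C zs :: real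
  assumes "q > p" and "p \<ge> 0"
    and "regular_with q p Q"
    and "n = real CARD('n)"
    and "C = (\<Sum>i\<in>UNIV. c $ i)"
    and "zs = (2 * (q + (n - 1) * p) * g - C) / n"
    and "\<And>i. xs $ i = (c $ i + zs - 2 * p * g) / (2 * q - 2 * p)"
  shows "(\<forall>x z. (Q *v x - (z / 2) *\<^sub>R 1 = (1 / 2) *\<^sub>R c \<and> 1 \<bullet> x = g) \<longleftrightarrow> (x = xs \<and> z = zs))
    \<and> (positive_definite Q \<longrightarrow>
         is_arg_min (\<lambda>x. x \<bullet> (Q *v x) - c \<bullet> x) (\<lambda>x. 1 \<bullet> x = g) xs)"
proof -
  have "q \<noteq> p"
    using assms(1) by simp
  have unique: "(Q *v x - (z / 2) *\<^sub>R 1 = (1 / 2) *\<^sub>R c \<and> 1 \<bullet> x = g) \<longleftrightarrow> (x = xs \<and> z = zs)" for x z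
    unfolding regular_system_iff[OF assms(3) \<open>q \<noteq> p\<close>] vec_eq_iff[of x xs] assms(7)
    using assms(4-6) by auto
  \<comment> \<open>Reading the equivalence backwards at \<open>xs\<close> and \<open>zs\<close>
    yields the Lagrange condition and feasibility.\<close>
  then have "Q *v xs - (zs / 2) *\<^sub>R 1 = (1 / 2) *\<^sub>R c" "1 \<bullet> xs = g"
    by blast+
  then show ?thesis
    using unique lagrange_point_is_arg_min regular_with_inner_commute[OF assms(3)] by blast
qed

end
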